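(* Let $f=P_{A_3}^2:\mathbb C^3\to\mathbb C^3$ and let $C\subset\mathbb C^3$ be the critical set of $f$. Then, in the coordinates $(p_1,p_2,q)$ of $R_3$, the set $\big(f(C)\cap R_3\big)\setminus\{\text{top and lower whiskers}\}$ is the tangent developable $\mathcal T$ of an astroid in space given by $$\chi(u,v)=(4\cos^3u,\ 4\sin^3u,\ 6\cos2u)+v(\cos u,\ -\sin u,\ 2),\qquad -\infty<v<\infty,\quad 0\le u<2\pi.$$
   Context: For $t_1,t_2,t_3\in\mathbb C\setminus\{0\}$ put $t_4=1/(t_1t_2t_3)$ and let $\Phi_1(t_1,t_2,t_3)=(z_1,z_2,z_3)$, where $z_j$ is the $j$-th elementary symmetric function of $t_1,t_2,t_3,t_4$. The polynomial map $P_{A_3}^d$ is determined by $P_{A_3}^d(\Phi_1(t_1,t_2,t_3))=\Phi_1(t_1^d,t_2^d,t_3^d)$; explicitly $P_{A_3}^2(z_1,z_2,z_3)=(z_1^2-2z_2,\ z_2^2-2z_1z_3+2,\ z_3^2-2z_2)$. $R_3=\{(z_1,z_2,\bar z_1):z_1\in\mathbb C,z_2\in\mathbb R\}$ with coordinates $(p_1,p_2,q)$, $z_1=p_1+ip_2$, $z_2=q$. The top whiskers are the points $(z_1,z_2,z_3)=\big(-2(r^2+r^{-2}),\ r^4+r^{-4}+4,\ -2(r^2+r^{-2})\big)$ and the lower whiskers are the points $(z_1,z_2,z_3)=\big(2i(r^2+r^{-2}),\ -r^4-r^{-4}-4,\ -2i(r^2+r^{-2})\big)$, with $r>0$, $r\ne1$.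 The astroid in space is the curve $u\mapsto(4\cos^3u,4\sin^3u,6\cos2u)$; its tangent developable is the ruled surface swept out by its tangent lines.
   Formalization: The whiskers are taken with both signs, z1 = ±2(r²+r⁻²) (top) and z1 = ±2i(r²+r⁻²) (lower), four in all; with only the printed signs the claim fails, e.g. at the critical value (17/2, 321/16, 17/2) of (0, −17/4, 0). *)

theory Defs
  imports "HOL-Analysis.Analysis" "HOL-Computational_Algebra.Fundamental_Theorem_Algebra"
begin

definition Phi1 :: "complex \<Rightarrow> complex \<Rightarrow> complex \<Rightarrow> complex^3" where
  "Phi1 t1 t2 t3 = (let t4 = 1 / (t1 * t2 * t3) in
     vector [t1 + t2 + t3 + t4,
             t1*t2 + t1*t3 + t1*t4 + t2*t3 + t2*t4 + t3*t4,
             t1*t2*t3 + t1*t2*t4 + t1*t3*t4 + t2*t3*t4])"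

text \<open>
  The map is determined by \<open>P (Phi1 t1 t2 t3) = Phi1 (t1^d) (t2^d) (t3^d)\<close>, since \<open>Phi1\<close> is
  surjective on nonzero arguments; see \<open>Phi1_surj\<close> and, for \<open>d = 2\<close>, \<open>PA3_2_Phi1\<close> and the
  explicit polynomial formula \<open>PA3_2\<close> below.
\<close>

definition PA3 :: "nat \<Rightarrow> complex^3 \<Rightarrow> complex^3" where
  "PA3 d z = (THE w. \<exists>t1 t2 t3. t1 \<noteq> 0 \<and> t2 \<noteq> 0 \<and> t3 \<noteq> 0 \<and>
     z = Phi1 t1 t2 t3 \<and> w = Phi1 (t1 ^ d) (t2 ^ d) (t3 ^ d))"

text \<open>
  \<^const>\<open>jacobian\<close> reads the matrix off the real Frechet derivative. For a complex polynomial map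
  this derivative is complex linear, so the entries are the complex partial derivatives.
\<close>

definition critical_set :: "(complex^3 \<Rightarrow> complex^3) \<Rightarrow> (complex^3) set" where
  "critical_set f = {z. det (jacobian f (at z)) = 0}"

definition R3 :: "(complex^3) set" where
  "R3 = {vector [z1, z2, cnj z1] | z1 z2. z2 \<in> \<real>}"

definition R3_coords :: "complex^3 \<Rightarrow> real^3" where
  "R3_coords z = vector [Re (z $ 1), Im (z $ 1), Re (z $ 2)]"

text \<open>
  There are two top and two lower whiskers, one for each sign \<open>s\<close>. All four consist of critical
  values with two double roots off the unit circle, namely
  \<open>t1 = t2 = c * r\<^sup>2\<close> and \<open>t3 = t4 = c / r\<^sup>2\<close> with \<open>c = s\<close> (top) or \<open>c = \<i> * s\<close> (lower).
\<close>

definition top_whiskers :: "(complex^3) set" where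
  "top_whiskers = {vector [of_real (s * 2 * (r\<^sup>2 + 1 / r\<^sup>2)),
                           of_real (r^4 + 1 / r^4 + 4),
                           of_real (s * 2 * (r\<^sup>2 + 1 / r\<^sup>2))]
                   | s r :: real. s \<in> {1, -1} \<and> r > 0 \<and> r \<noteq> 1}"

definition lower_whiskers :: "(complex^3) set" where
  "lower_whiskers = {vector [\<i> * of_real (s * 2 * (r\<^sup>2 + 1 / r\<^sup>2)),
                             of_real (- (r^4) - 1 / r^4 - 4),
                             - \<i> * of_real (s * 2 * (r\<^sup>2 + 1 / r\<^sup>2))]
                     | s r :: real. s \<in> {1, -1} \<and> r > 0 \<and> r \<noteq> 1}"

definition astroid :: "real \<Rightarrow> real^3" where
  "astroid u = vector [4 * cos u ^ 3, 4 * sin u ^ 3, 6 * cos (2 * u)]"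

text \<open>
  The tangent line is the limit of the secant lines: some rescaling of the secant vectors converges
  to the nonzero vector \<open>d\<close>. Where the derivative of the curve is nonzero, this says that \<open>d\<close> is a
  nonzero multiple of it. The derivative of the astroid vanishes at the multiples of \<open>pi / 2\<close>, and
  there this still gives the cuspidal tangent.
\<close>

definition tangent_direction :: "(real \<Rightarrow> 'a::real_normed_vector) \<Rightarrow> real \<Rightarrow> 'a \<Rightarrow> bool" where
  "tangent_direction \<gamma> u d \<longleftrightarrow>
     d \<noteq> 0 \<and> (\<exists>c :: real \<Rightarrow> real. ((\<lambda>t. c t *\<^sub>R (\<gamma> t - \<gamma> u)) \<longlongrightarrow> d) (at u))"

definition tangent_developable :: "(real \<Rightarrow> 'a::real_normed_vector) \<Rightarrow> 'a set" where
  "tangent_developable \<gamma> = {\<gamma> u + v *\<^sub>R d | u v d. tangent_direction \<gamma> u d}"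

definition chi :: "real \<Rightarrow> real \<Rightarrow> real^3" where
  "chi u v = vector [4 * cos u ^ 3, 4 * sin u ^ 3, 6 * cos (2 * u)]
             + v *\<^sub>R vector [cos u, - sin u, 2]"

lemma Phi1_surj:
  obtains t1 t2 t3 where "t1 \<noteq> 0" "t2 \<noteq> 0" "t3 \<noteq> 0" "z = Phi1 t1 t2 t3"
proof -
  define z1 z2 z3 where "z1 = z $ 1" and "z2 = z $ 2" and "z3 = z $ 3"
  obtain a where "poly [:1, -z3, z2, -z1, 1:] a = 0"
    using alg_closed_imp_poly_has_root[of "[:1, -z3, z2, -z1, 1:]"] by auto
  then have a: "1 + a * (-z3 + a * (z2 + a * (-z1 + a))) = 0" by simp
  define c2 where "c2 = a - z1"
  define c1 where "c1 = z2 + a * c2"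
  define c0 where "c0 = - z3 + a * c1"
  have ac0: "1 + a * c0 = 0" using a unfolding c0_def c1_def c2_def by (simp add: algebra_simps)
  obtain b where "poly [:c0, c1, c2, 1:] b = 0"
    using alg_closed_imp_poly_has_root[of "[:c0, c1, c2, 1:]"] by auto
  then have b: "c0 + b * (c1 + b * (c2 + b)) = 0" by simp
  define e1 where "e1 = c2 + b"
  define e0 where "e0 = c1 + b * e1"
  have be0: "c0 + b * e0 = 0" using b unfolding e0_def e1_def by simp
  obtain c where "poly [:e0, e1, 1:] c = 0"
    using alg_closed_imp_poly_has_root[of "[:e0, e1, 1:]"] by auto
  then have c: "e0 + c * (e1 + c) = 0" by simp
  define d where "d = - e1 - c"
  have cd: "e0 = c * d" using c unfolding d_def by algebra
  have prod: "a * b * c * d = 1"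
    using ac0 be0 cd by algebra
  then have nz: "a \<noteq> 0" "b \<noteq> 0" "c \<noteq> 0" by auto
  have d: "1 / (a * b * c) = d" using prod nz by (simp add: field_simps)
  have "z1 = a + b + c + d" unfolding d_def e1_def c2_def by simp
  moreover have "z2 = a*b + a*c + a*d + b*c + b*d + c*d"
    using cd unfolding e0_def c1_def d_def e1_def c2_def by algebra
  moreover have "z3 = a*b*c + a*b*d + a*c*d + b*c*d"
    using cd be0 unfolding e0_def c0_def c1_def d_def e1_def c2_def by algebra
  ultimately have "z = Phi1 a b c"
    unfolding Phi1_def Let_def d
    by (simp add: vec_eq_iff forall_3 z1_def z2_def z3_def)
  with nz show thesis by (rule that)
qed

lemma Phi1_square:
  assumes "t1 \<noteq> 0" "t2 \<noteq> 0" "t3 \<noteq> 0" "z = Phi1 t1 t2 t3"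
  shows "Phi1 (t1\<^sup>2) (t2\<^sup>2) (t3\<^sup>2) =
    vector [(z $ 1)\<^sup>2 - 2 * z $ 2, (z $ 2)\<^sup>2 - 2 * z $ 1 * z $ 3 + 2, (z $ 3)\<^sup>2 - 2 * z $ 2]"
proof -
  define t4 where "t4 = 1 / (t1 * t2 * t3)"
  have p: "t1 * t2 * t3 * t4 = 1" using assms by (simp add: t4_def)
  have t4': "1 / (t1\<^sup>2 * t2\<^sup>2 * t3\<^sup>2) = t4\<^sup>2"
    by (simp add: t4_def power_mult_distrib power_one_over)
  have e: "z $ 1 = t1 + t2 + t3 + t4"
    "z $ 2 = t1*t2 + t1*t3 + t1*t4 + t2*t3 + t2*t4 + t3*t4"
    "z $ 3 = t1*t2*t3 + t1*t2*t4 + t1*t3*t4 + t2*t3*t4"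
    by (simp_all add: assms(4) Phi1_def Let_def t4_def)
  have "t1\<^sup>2 + t2\<^sup>2 + t3\<^sup>2 + t4\<^sup>2 = (z $ 1)\<^sup>2 - 2 * z $ 2"
    unfolding e by algebra
  moreover have "t1\<^sup>2*t2\<^sup>2 + t1\<^sup>2*t3\<^sup>2 + t1\<^sup>2*t4\<^sup>2 + t2\<^sup>2*t3\<^sup>2 + t2\<^sup>2*t4\<^sup>2 + t3\<^sup>2*t4\<^sup>2
      = (z $ 2)\<^sup>2 - 2 * z $ 1 * z $ 3 + 2"
    using p unfolding e by algebra
  moreover have "t1\<^sup>2*t2\<^sup>2*t3\<^sup>2 + t1\<^sup>2*t2\<^sup>2*t4\<^sup>2 + t1\<^sup>2*t3\<^sup>2*t4\<^sup>2 + t2\<^sup>2*t3\<^sup>2*t4\<^sup>2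
      = (z $ 3)\<^sup>2 - 2 * z $ 2"
    using p unfolding e by algebra
  ultimately show ?thesis
    unfolding Phi1_def Let_def t4' by simp
qed

lemma PA3_2:
  "PA3 2 z =
    vector [(z $ 1)\<^sup>2 - 2 * z $ 2, (z $ 2)\<^sup>2 - 2 * z $ 1 * z $ 3 + 2, (z $ 3)\<^sup>2 - 2 * z $ 2]"
proof -
  obtain t1 t2 t3 where "t1 \<noteq> 0" "t2 \<noteq> 0" "t3 \<noteq> 0" "z = Phi1 t1 t2 t3"
    by (rule Phi1_surj)
  then show ?thesis
    unfolding PA3_def by (intro the_equality) (metis Phi1_square)+
qed

lemma PA3_2_Phi1:
  assumes "t1 \<noteq> 0" "t2 \<noteq> 0" "t3 \<noteq> 0"
  shows "PA3 2 (Phi1 t1 t2 t3) = Phi1 (t1\<^sup>2) (t2\<^sup>2) (t3\<^sup>2)"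
  using Phi1_square[OF assms refl] by (simp add: PA3_2)

end

theory Submission
  imports Defs
begin

text \<open>
  Think of a point \<open>w\<close> as the monic quartic \<open>x\<^sup>4 - w\<^sub>1 x\<^sup>3 + w\<^sub>2 x\<^sup>2 - w\<^sub>3 x + 1\<close>. The map squares its
  roots. The Jacobian determinant is a multiple of the product of all sums \<open>t\<^sub>i + t\<^sub>j\<close> of two roots,
  so a critical point has two opposite roots, and its image is a quartic with a double root \<open>a\<close>.
  Conversely, every quartic with a double root arises in this way: choose opposite square roots of
  \<open>a\<close>, and square roots of the other two roots with the right product (\<open>critical_values\<close>).

  A point lies in \<^const>\<open>R3\<close> exactly if its quartic is symmetric under \<open>x \<mapsto> 1 / cnj x\<close>, the
  reflection in the unit circle. Hence there are two cases for a double root \<open>a\<close>.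

  If \<open>a = cis u\<close> lies on the circle, then the symmetry forces the sum of the other two roots to be
  \<open>s * cis (- u)\<close> with a real \<open>s\<close>. With \<open>v = s - 2 * cos (2 * u)\<close> this is the point \<open>chi u v\<close>
  (\<open>double_root_on_circle\<close>, \<open>R3_point_chi\<close>).

  If \<open>a\<close> is off the circle, then its reflection is a second double root. The product of the roots is
  \<open>1\<close>, which makes \<open>a\<^sup>2\<close> real. For real \<open>a\<close> the quartic is on a top whisker, for imaginary \<open>a\<close> on a
  lower whisker (\<open>R3_critical_value_cases\<close>). A whisker point on the surface \<open>chi\<close> would
  need \<open>r\<^sup>2 + 1 / r\<^sup>2 \<le> 2\<close>, which contradicts \<open>r \<noteq> 1\<close>, so removing the whiskers removes no
  point of the surface.

  Finally, the derivative of the astroid at \<open>u\<close> is \<open>- 6 * sin (2 * u)\<close> times \<open>(cos u, - sin u, 2)\<close>. By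
  l'Hopital's rule the secants have the limit direction \<open>(cos u, - sin u, 2)\<close> at every \<open>u\<close>,
  including the cusps, where the derivative vanishes. So \<open>chi u\<close> parametrizes the tangent line
  at \<open>u\<close> (\<open>tangent_direction_astroid\<close>).
\<close>

section \<open>Critical values\<close>

lemma vec3_eq_iff: "x = y \<longleftrightarrow> x $ 1 = y $ 1 \<and> x $ 2 = y $ 2 \<and> x $ 3 = y $ 3" for x y :: "'a^3"
  by (simp add: vec_eq_iff forall_3)

lemma has_derivative_vecI:
  fixes f :: "'a::real_normed_vector \<Rightarrow> 'b::euclidean_space^'n"
  assumes "\<And>i. ((\<lambda>x. f x $ i) has_derivative (\<lambda>h. f' h $ i)) (at a within S)"
  shows "(f has_derivative f') (at a within S)"
proof (subst has_derivative_componentwise_within, intro ballI)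
  fix b :: "'b^'n" assume "b \<in> Basis"
  then obtain i c where b: "b = axis i c" by (auto simp: Basis_vec_def)
  show "((\<lambda>x. f x \<bullet> b) has_derivative (\<lambda>x. f' x \<bullet> b)) (at a within S)"
    unfolding b inner_axis by (intro has_derivative_inner_left assms)
qed

lemma PA3_2_has_derivative:
  "(PA3 2 has_derivative (\<lambda>h. vector [2 * z $ 1 * h $ 1 - 2 * h $ 2,
      2 * z $ 2 * h $ 2 - 2 * (z $ 1 * h $ 3 + h $ 1 * z $ 3), 2 * z $ 3 * h $ 3 - 2 * h $ 2])) (at z)"
proof (rule has_derivative_vecI)
  have nth: "((\<lambda>x. x $ j) has_derivative (\<lambda>h. h $ j)) (at z)" for j
    by (rule bounded_linear_imp_has_derivative[OF bounded_linear_vec_nth])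
  fix i :: 3
  show "((\<lambda>x. PA3 2 x $ i) has_derivative (\<lambda>h. vector [2 * z $ 1 * h $ 1 - 2 * h $ 2,
      2 * z $ 2 * h $ 2 - 2 * (z $ 1 * h $ 3 + h $ 1 * z $ 3), 2 * z $ 3 * h $ 3 - 2 * h $ 2] $ i)) (at z)"
    using exhaust_3[of i]
    by (auto simp: PA3_2 power2_eq_square algebra_simps intro!: derivative_eq_intros nth)
qed

lemma critical_set_PA3_2:
  "z \<in> critical_set (PA3 2) \<longleftrightarrow> z $ 1 * z $ 2 * z $ 3 = (z $ 1)\<^sup>2 + (z $ 3)\<^sup>2"
proof -
  have "det (jacobian (PA3 2) (at z)) = 8 * (z $ 1 * z $ 2 * z $ 3 - ((z $ 1)\<^sup>2 + (z $ 3)\<^sup>2))"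
    unfolding jacobian_def frechet_derivative_at[OF PA3_2_has_derivative, symmetric]
    by (simp add: det_3 matrix_def axis_def power2_eq_square algebra_simps)
  then show ?thesis unfolding critical_set_def mem_Collect_eq by (simp only: mult_eq_0_iff) simp
qed

text \<open>
  The elementary symmetric functions of the roots \<open>a, a, b, c\<close> with \<open>a\<^sup>2 * b * c = 1\<close> and
  \<open>b + c = e\<close>.
\<close>

definition double_root_point :: "complex \<Rightarrow> complex \<Rightarrow> complex^3" where
  "double_root_point a e = vector [2 * a + e, a\<^sup>2 + 2 * a * e + 1 / a\<^sup>2, a\<^sup>2 * e + 2 / a]"

text \<open>
  In terms of roots: a critical point has two opposite roots \<open>\<plusminus> sqrt a\<close>, and \<open>\<sigma>\<close> is the sum of the
  other two, whose product is \<open>- 1 / a\<close>.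
\<close>

lemma critical_set_param:
  "z \<in> critical_set (PA3 2) \<longleftrightarrow> (\<exists>a \<sigma>. a \<noteq> 0 \<and> z = vector [\<sigma>, - a - 1 / a, - (a * \<sigma>)])"
proof
  assume "z \<in> critical_set (PA3 2)"
  then have crit: "z $ 1 * z $ 2 * z $ 3 = (z $ 1)\<^sup>2 + (z $ 3)\<^sup>2"
    by (simp add: critical_set_PA3_2)
  have "\<exists>a. a \<noteq> 0 \<and> z $ 2 = - a - 1 / a \<and> z $ 3 = - (a * z $ 1)"
  proof (cases "z $ 1 = 0")
    case True
    then have "z $ 3 = 0" using crit by simp
    \<comment> \<open>The quartic is even, and \<open>a\<close> is the square of one of its roots.\<close>
    obtain a where "poly [:1, z $ 2, 1:] a = 0"
      using alg_closed_imp_poly_has_root[of "[:1, z $ 2, 1:]"] by auto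
    then have a: "1 + a * (z $ 2 + a) = 0" by simp
    then have "a \<noteq> 0" by auto
    moreover have "z $ 2 = - a - 1 / a"
      using \<open>a \<noteq> 0\<close> a by (simp add: field_simps) algebra
    ultimately show ?thesis using True \<open>z $ 3 = 0\<close> by auto
  next
    case False
    then have "z $ 3 \<noteq> 0" using crit by auto
    have "z $ 2 = z $ 1 / z $ 3 + z $ 3 / z $ 1"
      using False \<open>z $ 3 \<noteq> 0\<close> crit by (simp add: field_simps power2_eq_square)
    then show ?thesis
      using False \<open>z $ 3 \<noteq> 0\<close> by (intro exI[of _ "- (z $ 3 / z $ 1)"]) auto
  qed
  then show "\<exists>a \<sigma>. a \<noteq> 0 \<and> z = vector [\<sigma>, - a - 1 / a, - (a * \<sigma>)]"
    by (auto simp: vec3_eq_iff)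
next
  assume "\<exists>a \<sigma>. a \<noteq> 0 \<and> z = vector [\<sigma>, - a - 1 / a, - (a * \<sigma>)]"
  then show "z \<in> critical_set (PA3 2)"
    by (auto simp: critical_set_PA3_2 field_simps power2_eq_square)
qed

lemma PA3_2_critical:
  assumes "a \<noteq> 0"
  shows "PA3 2 (vector [\<sigma>, - a - 1 / a, - (a * \<sigma>)]) = double_root_point a (\<sigma>\<^sup>2 + 2 / a)"
  using assms by (simp add: PA3_2 double_root_point_def vec3_eq_iff field_simps power2_eq_square)

lemma critical_values:
  "PA3 2 ` critical_set (PA3 2) = {double_root_point a e | a e. a \<noteq> 0}"
proof (intro equalityI subsetI)
  fix w assume "w \<in> PA3 2 ` critical_set (PA3 2)"
  then show "w \<in> {double_root_point a e | a e. a \<noteq> 0}"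
    using PA3_2_critical by (fastforce simp: critical_set_param)
next
  fix w assume "w \<in> {double_root_point a e | a e. a \<noteq> 0}"
  then obtain a e where w: "a \<noteq> 0" "w = double_root_point a e" by auto
  \<comment> \<open>The sum \<open>\<sigma>\<close> of square roots of the two other roots has the square \<open>e - 2 / a\<close>.\<close>
  define z :: "complex^3"
    where "z = vector [csqrt (e - 2 / a), - a - 1 / a, - (a * csqrt (e - 2 / a))]"
  have "PA3 2 z = w"
    unfolding z_def PA3_2_critical[OF w(1)] by (simp add: w)
  moreover have "z \<in> critical_set (PA3 2)"
    using w(1) unfolding z_def critical_set_param by blast
  ultimately show "w \<in> PA3 2 ` critical_set (PA3 2)" by blast
qed

section \<open>Real critical values\<close>

text \<open>The inverse of \<^const>\<open>R3_coords\<close> on \<^const>\<open>R3\<close>.\<close>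

definition R3_point :: "real^3 \<Rightarrow> complex^3" where
  "R3_point x = vector [Complex (x $ 1) (x $ 2), of_real (x $ 3), cnj (Complex (x $ 1) (x $ 2))]"

lemma R3_coords_R3_point [simp]: "R3_coords (R3_point x) = x"
  by (simp add: R3_coords_def R3_point_def vec3_eq_iff)

lemma R3_point_in_R3: "R3_point x \<in> R3"
  unfolding R3_def R3_point_def mem_Collect_eq by (intro exI conjI) (rule refl, rule Reals_of_real)

lemma R3_point_R3_coords: "z \<in> R3 \<Longrightarrow> R3_point (R3_coords z) = z"
  by (auto simp: R3_def R3_coords_def R3_point_def complex_eq_iff vec3_eq_iff elim!: Reals_cases)

lemma chi_nth:
  "chi u v $ 1 = 4 * cos u ^ 3 + v * cos u"
  "chi u v $ 2 = 4 * sin u ^ 3 - v * sin u"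
  "chi u v $ 3 = 6 * cos (2 * u) + 2 * v"
  by (simp_all add: chi_def)

text \<open>
  The coordinates in terms of the parameter \<open>s = 2 * cos (2 * u) + v\<close>, which is the one that the
  double root at \<open>cis u\<close> produces.
\<close>

lemma chi_nth':
  "chi u v $ 1 = (2 + (2 * cos (2 * u) + v)) * cos u"
  "chi u v $ 2 = (2 - (2 * cos (2 * u) + v)) * sin u"
  "chi u v $ 3 = 2 * cos (2 * u) + 2 * (2 * cos (2 * u) + v)"
proof -
  show "chi u v $ 1 = (2 + (2 * cos (2 * u) + v)) * cos u"
    unfolding chi_nth cos_double_cos by algebra
  show "chi u v $ 2 = (2 - (2 * cos (2 * u) + v)) * sin u"
    unfolding chi_nth cos_double_sin by algebra
  show "chi u v $ 3 = 2 * cos (2 * u) + 2 * (2 * cos (2 * u) + v)"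
    unfolding chi_nth by algebra
qed

lemma R3_point_chi:
  "R3_point (chi u (s - 2 * cos (2 * u))) = double_root_point (cis u) (of_real s * cis (- u))"
proof -
  have 1: "cis u * cis (- u) = 1" "cis u ^ 2 * cis (- u) = cis u"
    by (simp_all add: power2_eq_square mult.assoc cis_mult)
  have 2: "cis u ^ 2 = cis (2 * u)" "1 / cis u = cis (- u)" "1 / cis (2 * u) = cis (- (2 * u))"
    by (simp_all add: Complex.DeMoivre divide_inverse)
  have "double_root_point (cis u) (of_real s * cis (- u)) =
      vector [2 * cis u + of_real s * cis (- u),
        cis (2 * u) + 2 * of_real s * (cis u * cis (- u)) + 1 / cis u ^ 2,
        of_real s * (cis u ^ 2 * cis (- u)) + 2 * (1 / cis u)]"
    unfolding double_root_point_def vec3_eq_iff vector_3 2(1)[symmetric] by simp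
  also have "\<dots> = R3_point (chi u (s - 2 * cos (2 * u)))"
    unfolding 1 unfolding 2 R3_point_def vec3_eq_iff vector_3 chi_nth'
    by (simp add: complex_eq_iff algebra_simps)
  finally show ?thesis by simp
qed

text \<open>
  Since \<open>1 / a = cnj a\<close>, the condition that the third coordinate is conjugate to the first one says
  that \<open>a * e\<close> is real. This real number is the parameter \<open>s\<close> of \<open>R3_point_chi\<close>.
\<close>

lemma double_root_on_circle:
  assumes "cmod a = 1" and w: "double_root_point a e = R3_point x"
  obtains u v where "0 \<le> u" "u < 2 * pi" "x = chi u v"
proof -
  have "(Re a)\<^sup>2 + (Im a)\<^sup>2 = 1" using assms(1) by (simp add: cmod_def)
  then obtain u where u: "0 \<le> u" "u < 2 * pi" "Re a = cos u" "Im a = sin u"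
    by (rule sincos_total_2pi)
  then have a: "a = cis u" by (simp add: complex_eq_iff)
  then have a0: "a \<noteq> 0" and ca: "1 / a = cnj a" by (auto simp: cis_cnj divide_inverse)
  have "a\<^sup>2 * e + 2 / a = cnj (2 * a + e)"
    using w by (simp add: double_root_point_def R3_point_def vec3_eq_iff)
  moreover have "2 / a = 2 * cnj a" unfolding ca[symmetric] by simp
  ultimately have "a\<^sup>2 * e = cnj e" by simp
  then have "a * e = cnj e * (1 / a)"
    using a0 by (simp add: field_simps power2_eq_square)
  then have "a * e = cnj (a * e)" unfolding ca by (simp add: mult.commute)
  then have "a * e \<in> \<real>" by (simp add: Reals_cnj_iff)
  then obtain s where "a * e = of_real s" by (rule Reals_cases)
  then have "e = of_real s * (1 / a)" using a0 by (simp add: field_simps)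
  then have "e = of_real s * cis (- u)" by (simp add: a divide_inverse)
  then have "R3_point x = R3_point (chi u (s - 2 * cos (2 * u)))"
    by (simp add: R3_point_chi a flip: w)
  then have "x = chi u (s - 2 * cos (2 * u))" by (metis R3_coords_R3_point)
  then show thesis using u that by blast
qed

text \<open>
  The quartic of \<open>double_root_point a e\<close> is \<open>(x - a)\<^sup>2 * (x\<^sup>2 - e * x + 1 / a\<^sup>2)\<close>. If it has another
  double root \<open>b\<close>, that is, if it vanishes at \<open>b\<close> together with its derivative, then \<open>b\<close> is a double
  root of the quadratic factor.
\<close>

lemma two_double_roots:
  fixes a b e :: complex
  defines "w \<equiv> double_root_point a e"
  assumes "a \<noteq> 0" "b \<noteq> a"
    and root: "b^4 - w $ 1 * b^3 + w $ 2 * b^2 - w $ 3 * b + 1 = 0"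
    and double: "4 * b^3 - 3 * w $ 1 * b^2 + 2 * w $ 2 * b - w $ 3 = 0"
  shows "e = 2 * b" "b\<^sup>2 = 1 / a\<^sup>2"
proof -
  define q where "q = b\<^sup>2 - e * b + 1 / a\<^sup>2"
  have "(b - a)\<^sup>2 * q = b^4 - w $ 1 * b^3 + w $ 2 * b^2 - w $ 3 * b + 1"
    using \<open>a \<noteq> 0\<close> unfolding w_def double_root_point_def vector_3 q_def
    by (simp add: field_simps eval_nat_numeral)
  then have q: "q = 0" using root \<open>b \<noteq> a\<close> by simp
  have "2 * (b - a) * q + (b - a)\<^sup>2 * (2 * b - e)
      = 4 * b^3 - 3 * w $ 1 * b^2 + 2 * w $ 2 * b - w $ 3"
    using \<open>a \<noteq> 0\<close> unfolding w_def double_root_point_def vector_3 q_def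
    by (simp add: field_simps eval_nat_numeral)
  then show "e = 2 * b" using double q \<open>b \<noteq> a\<close> by simp
  then show "b\<^sup>2 = 1 / a\<^sup>2" using q unfolding q_def by algebra
qed

text \<open>
  By the symmetry of the quartic in the unit circle, the reflection \<open>1 / cnj a\<close> is a second double
  root. For this root \<open>b\<close>, the equation \<open>b\<^sup>2 = 1 / a\<^sup>2\<close> of \<open>two_double_roots\<close> reads \<open>(cnj a)\<^sup>2 = a\<^sup>2\<close>.
\<close>

lemma double_root_off_circle:
  assumes "a \<noteq> 0" "cmod a \<noteq> 1" and wx: "double_root_point a e = R3_point x"
  shows "e = 2 / cnj a" "Re a = 0 \<or> Im a = 0"
proof -
  define w where "w = double_root_point a e"
  define b where "b = 1 / cnj a"
  have ba: "b * cnj a = 1" using \<open>a \<noteq> 0\<close> by (simp add: b_def)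
  have "b \<noteq> a"
  proof
    assume "b = a"
    then have "of_real ((cmod a)\<^sup>2) = (1::complex)"
      using ba unfolding complex_norm_square by (simp add: mult.commute)
    then have "(cmod a)\<^sup>2 = 1" by (simp only: of_real_eq_1_iff)
    then show False using \<open>cmod a \<noteq> 1\<close> by (simp add: power2_eq_1_iff) (smt (verit) norm_ge_zero)
  qed
  have cw: "cnj (w $ 1) = w $ 3" "cnj (w $ 2) = w $ 2" "cnj (w $ 3) = w $ 1"
    unfolding w_def wx by (simp_all add: R3_point_def)
  have "a^4 - w $ 1 * a^3 + w $ 2 * a^2 - w $ 3 * a + 1 = 0"
    using \<open>a \<noteq> 0\<close> unfolding w_def double_root_point_def vector_3
    by (simp add: field_simps eval_nat_numeral)
  then have "cnj (a^4 - w $ 1 * a^3 + w $ 2 * a^2 - w $ 3 * a + 1) = 0" by simp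
  then have r: "cnj a^4 - w $ 3 * cnj a^3 + w $ 2 * cnj a^2 - w $ 1 * cnj a + 1 = 0"
    by (simp add: cw)
  have "4 * a^3 - 3 * w $ 1 * a^2 + 2 * w $ 2 * a - w $ 3 = 0"
    using \<open>a \<noteq> 0\<close> unfolding w_def double_root_point_def vector_3
    by (simp add: field_simps eval_nat_numeral)
  then have "cnj (4 * a^3 - 3 * w $ 1 * a^2 + 2 * w $ 2 * a - w $ 3) = 0" by simp
  then have d: "4 * cnj a^3 - 3 * w $ 3 * cnj a^2 + 2 * w $ 2 * cnj a - w $ 1 = 0"
    by (simp add: cw)
  \<comment> \<open>Conjugation turned the quartic into its reciprocal quartic, so the equations at \<open>cnj a\<close> are
    equations for the original quartic at \<open>b = 1 / cnj a\<close>.\<close>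
  have ca: "cnj a = 1 / b" and "b \<noteq> 0" using \<open>a \<noteq> 0\<close> by (simp_all add: b_def)
  have root: "b^4 - w $ 1 * b^3 + w $ 2 * b^2 - w $ 3 * b + 1 = 0"
  proof -
    have "b^4 - w $ 1 * b^3 + w $ 2 * b^2 - w $ 3 * b + 1
        = b^4 * (cnj a^4 - w $ 3 * cnj a^3 + w $ 2 * cnj a^2 - w $ 1 * cnj a + 1)"
      unfolding ca using \<open>b \<noteq> 0\<close> by (simp add: field_simps eval_nat_numeral)
    then show ?thesis using r by simp
  qed
  have double: "4 * b^3 - 3 * w $ 1 * b^2 + 2 * w $ 2 * b - w $ 3 = 0"
  proof -
    have "b * (4 * b^3 - 3 * w $ 1 * b^2 + 2 * w $ 2 * b - w $ 3)
        = 4 * (b^4 - w $ 1 * b^3 + w $ 2 * b^2 - w $ 3 * b + 1)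
          - b^3 * (4 * cnj a^3 - 3 * w $ 3 * cnj a^2 + 2 * w $ 2 * cnj a - w $ 1)"
      unfolding ca using \<open>b \<noteq> 0\<close> by (simp add: field_simps eval_nat_numeral)
    then show ?thesis using root d \<open>b \<noteq> 0\<close> by simp
  qed
  note * = two_double_roots[OF \<open>a \<noteq> 0\<close> \<open>b \<noteq> a\<close> root[unfolded w_def] double[unfolded w_def]]
  show "e = 2 / cnj a" using *(1) by (simp add: b_def)
  have "(cnj a)\<^sup>2 = a\<^sup>2" using *(2) \<open>a \<noteq> 0\<close> by (simp add: b_def field_simps)
  then have "cnj a = a \<or> cnj a = - a" by (simp add: power2_eq_iff)
  then show "Re a = 0 \<or> Im a = 0" by (auto simp: complex_eq_iff)
qed

text \<open>
  The sign \<open>s\<close> and the parameter \<open>r\<close> of a whisker encode the two double roots: with \<open>\<rho> = s * r\<^sup>2\<close>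
  these are \<open>\<rho>\<close> and \<open>1 / \<rho>\<close>, multiplied by \<open>\<i>\<close> for a lower whisker.
\<close>

lemma whisker_parameter_exists:
  fixes \<rho> :: real
  assumes "\<rho> \<noteq> 0" "\<bar>\<rho>\<bar> \<noteq> 1"
  obtains s r :: real where "s \<in> {1, -1}" "r > 0" "r \<noteq> 1"
    "s * 2 * (r\<^sup>2 + 1 / r\<^sup>2) = 2 * (\<rho> + 1 / \<rho>)" "r^4 = \<rho>\<^sup>2"
proof -
  define r where "r = sqrt \<bar>\<rho>\<bar>"
  have "r > 0" "r \<noteq> 1" and r2: "r\<^sup>2 = \<bar>\<rho>\<bar>" using assms by (simp_all add: r_def)
  moreover have "r^4 = \<rho>\<^sup>2" using r2 power_mult[of r 2 2] by simp
  moreover have "sgn \<rho> * 2 * (r\<^sup>2 + 1 / r\<^sup>2) = 2 * (\<rho> + 1 / \<rho>)"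
    unfolding r2 using assms(1) by (simp add: sgn_if)
  moreover have "sgn \<rho> \<in> {1, -1}" using assms(1) by (simp add: sgn_if)
  ultimately show thesis using that by blast
qed

lemma two_real_double_roots_in_top_whiskers:
  fixes \<rho> :: real
  assumes "\<rho> \<noteq> 0" "\<bar>\<rho>\<bar> \<noteq> 1"
  shows "double_root_point (of_real \<rho>) (2 / of_real \<rho>) \<in> top_whiskers"
proof -
  obtain s r :: real where sr: "s \<in> {1, -1}" "r > 0" "r \<noteq> 1"
    and \<rho>: "s * 2 * (r\<^sup>2 + 1 / r\<^sup>2) = 2 * (\<rho> + 1 / \<rho>)" "r^4 = \<rho>\<^sup>2"
    by (rule whisker_parameter_exists[OF assms])
  have "double_root_point (of_real \<rho>) (2 / of_real \<rho>) =
      vector [of_real (s * 2 * (r\<^sup>2 + 1 / r\<^sup>2)), of_real (r^4 + 1 / r^4 + 4),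
        of_real (s * 2 * (r\<^sup>2 + 1 / r\<^sup>2))]"
    unfolding \<rho> double_root_point_def vec3_eq_iff vector_3
    using assms(1) by (simp add: power2_eq_square)
  then show ?thesis unfolding top_whiskers_def using sr by blast
qed

lemma two_imaginary_double_roots_in_lower_whiskers:
  fixes \<rho> :: real
  assumes "\<rho> \<noteq> 0" "\<bar>\<rho>\<bar> \<noteq> 1"
  shows "double_root_point (\<i> * of_real \<rho>) (2 * \<i> / of_real \<rho>) \<in> lower_whiskers"
proof -
  obtain s r :: real where sr: "s \<in> {1, -1}" "r > 0" "r \<noteq> 1"
    and \<rho>: "s * 2 * (r\<^sup>2 + 1 / r\<^sup>2) = 2 * (\<rho> + 1 / \<rho>)" "r^4 = \<rho>\<^sup>2"
    by (rule whisker_parameter_exists[OF assms])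
  have "double_root_point (\<i> * of_real \<rho>) (2 * \<i> / of_real \<rho>) =
      vector [\<i> * of_real (s * 2 * (r\<^sup>2 + 1 / r\<^sup>2)), of_real (- (r^4) - 1 / r^4 - 4),
        - \<i> * of_real (s * 2 * (r\<^sup>2 + 1 / r\<^sup>2))]"
    unfolding \<rho> double_root_point_def vec3_eq_iff vector_3
    using assms(1) by (simp add: power2_eq_square field_simps)
  then show ?thesis unfolding lower_whiskers_def using sr by blast
qed

lemma R3_critical_value_cases:
  assumes "a \<noteq> 0" "double_root_point a e = R3_point x"
  shows "(\<exists>u v. 0 \<le> u \<and> u < 2 * pi \<and> x = chi u v) \<or> R3_point x \<in> top_whiskers \<union> lower_whiskers"
proof (cases "cmod a = 1")
  case True
  then show ?thesis using assms(2) double_root_on_circle by metis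
next
  case False
  note * = double_root_off_circle[OF assms(1) False assms(2)]
  from *(2) show ?thesis
  proof
    assume "Im a = 0"
    then have a: "a = of_real (Re a)" by (simp add: complex_eq_iff)
    then have "cmod a = \<bar>Re a\<bar>" "Re a \<noteq> 0" using assms(1) by (metis norm_of_real, auto)
    moreover have "cnj a = a" by (subst a, subst (2) a) simp
    ultimately show ?thesis
      using two_real_double_roots_in_top_whiskers[of "Re a"] False *(1) assms(2) a by simp
  next
    assume "Re a = 0"
    then have a: "a = \<i> * of_real (Im a)" by (simp add: complex_eq_iff)
    then have "Im a \<noteq> 0" using assms(1) by auto
    moreover have "cmod a = \<bar>Im a\<bar>" using \<open>Re a = 0\<close> by (simp add: cmod_def)
    moreover have "2 / cnj a = 2 * \<i> / of_real (Im a)"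
      using \<open>Re a = 0\<close> \<open>Im a \<noteq> 0\<close> by (subst a) (simp add: field_simps)
    ultimately show ?thesis
      using two_imaginary_double_roots_in_lower_whiskers[of "Im a"] False *(1) assms(2) a by simp
  qed
qed

lemma whisker_parameter:
  fixes r :: real
  assumes "r > 0" "r \<noteq> 1"
  shows "r\<^sup>2 + 1 / r\<^sup>2 > 2" "r^4 + 1 / r^4 + 2 = (r\<^sup>2 + 1 / r\<^sup>2)\<^sup>2"
proof -
  have "r\<^sup>2 \<noteq> 1" using assms by (simp add: power2_eq_1_iff)
  then have "r - 1 / r \<noteq> 0" using assms by (simp add: field_simps power2_eq_square)
  then have "(r - 1 / r)\<^sup>2 > 0" by simp
  then show "r\<^sup>2 + 1 / r\<^sup>2 > 2" using assms by (simp add: power2_diff power_one_over)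
  show "r^4 + 1 / r^4 + 2 = (r\<^sup>2 + 1 / r\<^sup>2)\<^sup>2"
    using assms by (simp add: power2_sum power_one_over flip: power_mult)
qed

text \<open>
  With \<open>M = r\<^sup>2 + 1 / r\<^sup>2 > 2\<close>, the whisker point has the coordinates \<open>(\<plusminus> 2 * M, 0, M\<^sup>2 + 2)\<close>. The
  vanishing second coordinate of \<open>chi u v\<close> leaves two cases: either \<open>\<plusminus> M = 2 * cos u\<close>, which is
  too small, or \<open>sin u = 0\<close>, and then eliminating \<open>t\<close> from the other two coordinates gives
  \<open>(M\<^sup>2 - 4)\<^sup>2 = 0\<close>.
\<close>

lemma chi_notin_top_whiskers: "R3_point (chi u v) \<notin> top_whiskers"
proof
  assume "R3_point (chi u v) \<in> top_whiskers"
  then obtain s r :: real where sr: "s \<in> {1, -1}" "r > 0" "r \<noteq> 1"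
    and eq: "R3_point (chi u v) = vector [of_real (s * 2 * (r\<^sup>2 + 1 / r\<^sup>2)),
      of_real (r^4 + 1 / r^4 + 4), of_real (s * 2 * (r\<^sup>2 + 1 / r\<^sup>2))]"
    unfolding top_whiskers_def by blast
  define M where "M = r\<^sup>2 + 1 / r\<^sup>2"
  define t where "t = 2 * cos (2 * u) + v"
  have M: "M > 2" "r^4 + 1 / r^4 + 2 = M\<^sup>2"
    unfolding M_def by (rule whisker_parameter[OF sr(2,3)])+
  have R: "R3_coords (R3_point (chi u v)) = vector [2 * s * M, 0, M\<^sup>2 + 2]"
    unfolding eq R3_coords_def vec3_eq_iff vector_3 M_def[symmetric] using M(2) by simp
  have c: "(2 + t) * cos u = 2 * s * M" "(2 - t) * sin u = 0" "2 * cos (2 * u) + 2 * t = M\<^sup>2 + 2"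
    using R by (simp_all add: vec3_eq_iff chi_nth' t_def)
  have s: "s\<^sup>2 = 1" using sr(1) by auto
  from c(2) consider "t = 2" | "sin u = 0" by auto
  then show False
  proof cases
    case 1
    then have "s * M = 2 * cos u" using c(1) by simp
    then have "\<bar>s * M\<bar> \<le> 2" using abs_cos_le_one[of u] by linarith
    then show False using sr(1) M(1) by auto
  next
    case 2
    then have "(cos u)\<^sup>2 = 1" using sin_cos_squared_add[of u] by simp
    then have "cos (2 * u) = 1" by (simp add: cos_double_cos)
    then have "M\<^sup>2 = 2 * t" using c(3) by simp
    have "((2 + t) * cos u)\<^sup>2 = (2 * s * M)\<^sup>2" using c(1) by simp
    then have "(2 + t)\<^sup>2 = (2 * M)\<^sup>2" using s \<open>(cos u)\<^sup>2 = 1\<close> by (simp add: power_mult_distrib)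
    then have "(M\<^sup>2 - 4)\<^sup>2 = 0" using \<open>M\<^sup>2 = 2 * t\<close> by algebra
    then have "M\<^sup>2 = 2\<^sup>2" by simp
    then have "M = 2" using M(1) power2_eq_imp_eq[of M 2] by simp
    then show False using M(1) by simp
  qed
qed

text \<open>
  The argument for the top whiskers, with the roles of sine and cosine exchanged: the whisker point is
  \<open>(0, \<plusminus> 2 * M, - M\<^sup>2 - 2)\<close>.
\<close>

lemma chi_notin_lower_whiskers: "R3_point (chi u v) \<notin> lower_whiskers"
proof
  assume "R3_point (chi u v) \<in> lower_whiskers"
  then obtain s r :: real where sr: "s \<in> {1, -1}" "r > 0" "r \<noteq> 1"
    and eq: "R3_point (chi u v) = vector [\<i> * of_real (s * 2 * (r\<^sup>2 + 1 / r\<^sup>2)),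
      of_real (- (r^4) - 1 / r^4 - 4), - \<i> * of_real (s * 2 * (r\<^sup>2 + 1 / r\<^sup>2))]"
    unfolding lower_whiskers_def by blast
  define M where "M = r\<^sup>2 + 1 / r\<^sup>2"
  define t where "t = 2 * cos (2 * u) + v"
  have M: "M > 2" "r^4 + 1 / r^4 + 2 = M\<^sup>2"
    unfolding M_def by (rule whisker_parameter[OF sr(2,3)])+
  have R: "R3_coords (R3_point (chi u v)) = vector [0, 2 * s * M, - (M\<^sup>2) - 2]"
    unfolding eq R3_coords_def vec3_eq_iff vector_3 M_def[symmetric] using M(2) by simp
  have c: "(2 + t) * cos u = 0" "(2 - t) * sin u = 2 * s * M" "2 * cos (2 * u) + 2 * t = - (M\<^sup>2) - 2"
    using R by (simp_all add: vec3_eq_iff chi_nth' t_def)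
  have s: "s\<^sup>2 = 1" using sr(1) by auto
  from c(1) consider "t = - 2" | "cos u = 0" by auto
  then show False
  proof cases
    case 1
    then have "s * M = 2 * sin u" using c(2) by simp
    then have "\<bar>s * M\<bar> \<le> 2" using abs_sin_le_one[of u] by linarith
    then show False using sr(1) M(1) by auto
  next
    case 2
    then have "(sin u)\<^sup>2 = 1" using sin_cos_squared_add[of u] by simp
    then have "cos (2 * u) = - 1" by (simp add: cos_double_sin)
    then have "M\<^sup>2 = - 2 * t" using c(3) by simp
    have "((2 - t) * sin u)\<^sup>2 = (2 * s * M)\<^sup>2" using c(2) by simp
    then have "(2 - t)\<^sup>2 = (2 * M)\<^sup>2" using s \<open>(sin u)\<^sup>2 = 1\<close> by (simp add: power_mult_distrib)
    then have "(M\<^sup>2 - 4)\<^sup>2 = 0" using \<open>M\<^sup>2 = - 2 * t\<close> by algebra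
    then have "M\<^sup>2 = 2\<^sup>2" by simp
    then have "M = 2" using M(1) power2_eq_imp_eq[of M 2] by simp
    then show False using M(1) by simp
  qed
qed

lemma real_critical_values:
  "R3_coords ` ((PA3 2 ` critical_set (PA3 2) \<inter> R3) - (top_whiskers \<union> lower_whiskers))
    = {chi u v | u v. 0 \<le> u \<and> u < 2 * pi}"
proof (intro equalityI subsetI)
  fix x assume "x \<in> R3_coords ` ((PA3 2 ` critical_set (PA3 2) \<inter> R3) - (top_whiskers \<union> lower_whiskers))"
  then obtain a e where "a \<noteq> 0" "double_root_point a e \<in> R3"
      "double_root_point a e \<notin> top_whiskers \<union> lower_whiskers" "x = R3_coords (double_root_point a e)"
    unfolding critical_values by blast
  then show "x \<in> {chi u v | u v. 0 \<le> u \<and> u < 2 * pi}"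
    using R3_critical_value_cases[of a e x] by (fastforce simp: R3_point_R3_coords)
next
  fix x assume "x \<in> {chi u v | u v. 0 \<le> u \<and> u < 2 * pi}"
  then obtain u v where x: "x = chi u v" by blast
  have "R3_point x = double_root_point (cis u) (of_real (v + 2 * cos (2 * u)) * cis (- u))"
    using R3_point_chi[of u "v + 2 * cos (2 * u)"] by (simp add: x)
  then have "R3_point x \<in> PA3 2 ` critical_set (PA3 2)"
    unfolding critical_values using cis_neq_zero by blast
  then show "x \<in> R3_coords ` ((PA3 2 ` critical_set (PA3 2) \<inter> R3) - (top_whiskers \<union> lower_whiskers))"
    using chi_notin_top_whiskers chi_notin_lower_whiskers R3_point_in_R3
    by (intro image_eqI[of _ _ "R3_point x"]) (auto simp: x)
qed

section \<open>The tangent developable of the astroid\<close>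

text \<open>
  If one rescaling of the secant vectors converges to \<open>w \<noteq> 0\<close>, then every convergent rescaling
  converges to a multiple of \<open>w\<close>: the quotient of the two scale factors can be recovered from the
  inner products with \<open>w\<close>, and therefore converges as well.
\<close>

lemma tangent_direction_iff:
  fixes \<gamma> :: "real \<Rightarrow> 'a::real_inner"
  assumes g: "eventually (\<lambda>t. g t \<noteq> 0) (at u)"
    and lim: "((\<lambda>t. (\<gamma> t - \<gamma> u) /\<^sub>R g t) \<longlongrightarrow> w) (at u)"
    and "w \<noteq> 0"
  shows "tangent_direction \<gamma> u d \<longleftrightarrow> (\<exists>k. k \<noteq> 0 \<and> d = k *\<^sub>R w)"
proof
  assume "tangent_direction \<gamma> u d"
  then obtain c where "d \<noteq> 0" and c: "((\<lambda>t. c t *\<^sub>R (\<gamma> t - \<gamma> u)) \<longlongrightarrow> d) (at u)"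
    unfolding tangent_direction_def by blast
  define q where "q t = (\<gamma> t - \<gamma> u) /\<^sub>R g t" for t
  have q: "(q \<longlongrightarrow> w) (at u)" using lim by (simp add: q_def[abs_def])
  have "eventually (\<lambda>t. c t *\<^sub>R (\<gamma> t - \<gamma> u) = (c t * g t) *\<^sub>R q t) (at u)"
    using g by eventually_elim (simp add: q_def)
  then have cq: "((\<lambda>t. (c t * g t) *\<^sub>R q t) \<longlongrightarrow> d) (at u)"
    by (rule Lim_transform_eventually[OF c])
  have ww: "w \<bullet> w \<noteq> 0" using \<open>w \<noteq> 0\<close> by simp
  have qw: "((\<lambda>t. q t \<bullet> w) \<longlongrightarrow> w \<bullet> w) (at u)" by (intro tendsto_intros q)
  have "((\<lambda>t. ((c t * g t) *\<^sub>R q t) \<bullet> w / (q t \<bullet> w)) \<longlongrightarrow> d \<bullet> w / (w \<bullet> w)) (at u)"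
    by (intro tendsto_intros cq qw ww)
  moreover have "eventually (\<lambda>t. ((c t * g t) *\<^sub>R q t) \<bullet> w / (q t \<bullet> w) = c t * g t) (at u)"
    using tendsto_imp_eventually_ne[OF qw ww] by eventually_elim simp
  ultimately have "((\<lambda>t. c t * g t) \<longlongrightarrow> d \<bullet> w / (w \<bullet> w)) (at u)"
    by (rule Lim_transform_eventually)
  then have "((\<lambda>t. (c t * g t) *\<^sub>R q t) \<longlongrightarrow> (d \<bullet> w / (w \<bullet> w)) *\<^sub>R w) (at u)"
    by (intro tendsto_intros q)
  then have "d = (d \<bullet> w / (w \<bullet> w)) *\<^sub>R w"
    using cq by (intro tendsto_unique[of "at u"]) auto
  then show "\<exists>k. k \<noteq> 0 \<and> d = k *\<^sub>R w" using \<open>d \<noteq> 0\<close> by (metis scaleR_zero_left)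
next
  assume "\<exists>k. k \<noteq> 0 \<and> d = k *\<^sub>R w"
  then obtain k where "k \<noteq> 0" "d = k *\<^sub>R w" by blast
  moreover have "((\<lambda>t. (k / g t) *\<^sub>R (\<gamma> t - \<gamma> u)) \<longlongrightarrow> k *\<^sub>R w) (at u)"
    using tendsto_scaleR[OF tendsto_const[of k] lim] by (simp add: divide_inverse)
  ultimately show "tangent_direction \<gamma> u d"
    using \<open>w \<noteq> 0\<close> unfolding tangent_direction_def by auto
qed

text \<open>Every zero of \<open>sin\<close> is simple and hence isolated.\<close>

lemma eventually_sin_add_ne_0: "eventually (\<lambda>t. sin (t + c) \<noteq> 0) (at (u::real))"
proof (cases "sin (u + c) = 0")
  case True
  have "((\<lambda>t. sin (t + c)) has_field_derivative cos (u + c)) (at u)"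
    by (auto intro!: derivative_eq_intros)
  then have "((\<lambda>t. sin (t + c) / (t - u)) \<longlongrightarrow> cos (u + c)) (at u)"
    by (simp add: has_field_derivative_iff True)
  moreover have "cos (u + c) \<noteq> 0"
    using True sin_zero_abs_cos_one by fastforce
  ultimately have "eventually (\<lambda>t. sin (t + c) / (t - u) \<noteq> 0) (at u)"
    by (rule tendsto_imp_eventually_ne)
  then show ?thesis by eventually_elim auto
next
  case False
  have "((\<lambda>t. sin (t + c)) \<longlongrightarrow> sin (u + c)) (at u)" by (intro tendsto_intros)
  then show ?thesis using False by (rule tendsto_imp_eventually_ne)
qed

lemma eventually_sin_double_ne_0: "eventually (\<lambda>t. sin (2 * t) \<noteq> 0) (at (u::real))"
  using eventually_sin_add_ne_0[of 0 u] eventually_sin_add_ne_0[of "pi / 2" u]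
  by eventually_elim (simp add: sin_double sin_add)

text \<open>
  Dividing the secant vectors by their third coordinate makes the limit exist at the cusps too. There
  the derivative of the third coordinate vanishes, but at no other point nearby, so l'Hopital's rule
  applies to the quotients of the coordinates.
\<close>

lemma astroid_secants:
  defines "g \<equiv> \<lambda>u t. astroid t $ 3 - astroid u $ 3"
  shows "eventually (\<lambda>t. g u t \<noteq> 0) (at u)"
    and "((\<lambda>t. (astroid t - astroid u) /\<^sub>R g u t)
      \<longlongrightarrow> (1/2) *\<^sub>R vector [cos u, - sin u, 2]) (at u)"
proof -
  have g: "g u t = - 12 * (sin (t + u) * sin (t + - u))" for t
    using cos_diff_cos[of "2 * t" "2 * u"] sin_minus[of "t - u"]
    by (simp add: g_def astroid_def add_divide_distrib diff_divide_distrib)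
  show ne: "eventually (\<lambda>t. g u t \<noteq> 0) (at u)"
    using eventually_sin_add_ne_0[of u u] eventually_sin_add_ne_0[of "- u" u]
    by eventually_elim (simp add: g)
  have g0: "(g u \<longlongrightarrow> 0) (at u)"
    unfolding g by (auto intro!: tendsto_eq_intros)
  have g': "eventually (\<lambda>t. (g u has_field_derivative - 12 * sin (2 * t)) (at t)) (at u)"
    unfolding g_def astroid_def vector_3
    by (intro always_eventually allI) (auto intro!: derivative_eq_intros)
  have g'0: "eventually (\<lambda>t. - 12 * sin (2 * t) \<noteq> 0) (at u)"
    using eventually_sin_double_ne_0[of u] by simp
  have 1: "((\<lambda>t. (4 * cos t ^ 3 - 4 * cos u ^ 3) / g u t) \<longlongrightarrow> cos u / 2) (at u)"
  proof (rule lhopital[OF _ g0 ne g'0 _ g'])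
    show "((\<lambda>t. 4 * cos t ^ 3 - 4 * cos u ^ 3) \<longlongrightarrow> 0) (at u)"
      by (auto intro!: tendsto_eq_intros)
    show "eventually (\<lambda>t. ((\<lambda>t. 4 * cos t ^ 3 - 4 * cos u ^ 3) has_field_derivative
        - 12 * (cos t)\<^sup>2 * sin t) (at t)) (at u)"
      by (intro always_eventually allI) (auto intro!: derivative_eq_intros)
    have "((\<lambda>t. cos t / 2) \<longlongrightarrow> cos u / 2) (at u)" by (intro tendsto_intros) auto
    moreover have "eventually (\<lambda>t. cos t / 2 = - 12 * (cos t)\<^sup>2 * sin t / (- 12 * sin (2 * t))) (at u)"
      using g'0 by eventually_elim (simp add: sin_double power2_eq_square)
    ultimately show "((\<lambda>t. - 12 * (cos t)\<^sup>2 * sin t / (- 12 * sin (2 * t))) \<longlongrightarrow> cos u / 2) (at u)"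
      by (rule Lim_transform_eventually)
  qed
  have 2: "((\<lambda>t. (4 * sin t ^ 3 - 4 * sin u ^ 3) / g u t) \<longlongrightarrow> - sin u / 2) (at u)"
  proof (rule lhopital[OF _ g0 ne g'0 _ g'])
    show "((\<lambda>t. 4 * sin t ^ 3 - 4 * sin u ^ 3) \<longlongrightarrow> 0) (at u)"
      by (auto intro!: tendsto_eq_intros)
    show "eventually (\<lambda>t. ((\<lambda>t. 4 * sin t ^ 3 - 4 * sin u ^ 3) has_field_derivative
        12 * (sin t)\<^sup>2 * cos t) (at t)) (at u)"
      by (intro always_eventually allI) (auto intro!: derivative_eq_intros)
    have "((\<lambda>t. - sin t / 2) \<longlongrightarrow> - sin u / 2) (at u)" by (intro tendsto_intros) auto
    moreover have "eventually (\<lambda>t. - sin t / 2 = 12 * (sin t)\<^sup>2 * cos t / (- 12 * sin (2 * t))) (at u)"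
      using g'0 by eventually_elim (simp add: sin_double power2_eq_square)
    ultimately show "((\<lambda>t. 12 * (sin t)\<^sup>2 * cos t / (- 12 * sin (2 * t))) \<longlongrightarrow> - sin u / 2) (at u)"
      by (rule Lim_transform_eventually)
  qed
  have "eventually (\<lambda>t. 1 = g u t / g u t) (at u)" using ne by eventually_elim simp
  then have 3: "((\<lambda>t. g u t / g u t) \<longlongrightarrow> 1) (at u)"
    by (rule Lim_transform_eventually[OF tendsto_const])
  show "((\<lambda>t. (astroid t - astroid u) /\<^sub>R g u t)
      \<longlongrightarrow> (1/2) *\<^sub>R vector [cos u, - sin u, 2]) (at u)"
  proof (rule vec_tendstoI)
    fix i :: 3
    have "((astroid t - astroid u) /\<^sub>R g u t) $ 1 = (4 * cos t ^ 3 - 4 * cos u ^ 3) / g u t"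
      "((astroid t - astroid u) /\<^sub>R g u t) $ 2 = (4 * sin t ^ 3 - 4 * sin u ^ 3) / g u t"
      "((astroid t - astroid u) /\<^sub>R g u t) $ 3 = g u t / g u t" for t
      unfolding vector_scaleR_component vector_minus_component g_def
      by (simp_all only: astroid_def vector_3 divide_inverse real_scaleR_def mult.commute)
    moreover have "((1/2) *\<^sub>R vector [cos u, - sin u, 2 :: real] :: real^3) $ 1 = cos u / 2"
      "((1/2) *\<^sub>R vector [cos u, - sin u, 2 :: real] :: real^3) $ 2 = - sin u / 2"
      "((1/2) *\<^sub>R vector [cos u, - sin u, 2 :: real] :: real^3) $ 3 = 1"
      by simp_all
    ultimately show "((\<lambda>t. ((astroid t - astroid u) /\<^sub>R g u t) $ i)
        \<longlongrightarrow> ((1/2) *\<^sub>R vector [cos u, - sin u, 2]) $ i) (at u)"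
      using exhaust_3[of i] by (elim disjE) (simp_all only: 1 2 3)
  qed
qed

lemma tangent_direction_astroid:
  "tangent_direction astroid u d \<longleftrightarrow> (\<exists>k. k \<noteq> 0 \<and> d = k *\<^sub>R vector [cos u, - sin u, 2])"
proof -
  have "vector [cos u, - sin u, 2] \<noteq> (0::real^3)" by (simp add: vec3_eq_iff)
  then have "tangent_direction astroid u d \<longleftrightarrow>
      (\<exists>k. k \<noteq> 0 \<and> d = k *\<^sub>R ((1/2) *\<^sub>R vector [cos u, - sin u, 2]))"
    by (intro tangent_direction_iff[OF astroid_secants]) simp
  also have "\<dots> \<longleftrightarrow> (\<exists>k. k \<noteq> 0 \<and> d = k *\<^sub>R vector [cos u, - sin u, 2])"
  proof
    assume "\<exists>k. k \<noteq> 0 \<and> d = k *\<^sub>R vector [cos u, - sin u, 2]"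
    then obtain k where "k \<noteq> 0" "d = k *\<^sub>R vector [cos u, - sin u, 2]" by blast
    then show "\<exists>k. k \<noteq> 0 \<and> d = k *\<^sub>R ((1/2) *\<^sub>R vector [cos u, - sin u, 2])"
      by (intro exI[of _ "2 * k"]) simp
  next
    assume "\<exists>k. k \<noteq> 0 \<and> d = k *\<^sub>R ((1/2) *\<^sub>R vector [cos u, - sin u, 2])"
    then obtain k where "k \<noteq> 0" "d = k *\<^sub>R ((1/2) *\<^sub>R vector [cos u, - sin u, 2])" by blast
    then show "\<exists>k. k \<noteq> 0 \<and> d = k *\<^sub>R vector [cos u, - sin u, 2]"
      by (intro exI[of _ "k / 2"]) simp
  qed
  finally show ?thesis .
qed

lemma tangent_developable_astroid:
  "tangent_developable astroid = {chi u v | u v. 0 \<le> u \<and> u < 2 * pi}"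
proof (intro equalityI subsetI)
  fix x assume "x \<in> tangent_developable astroid"
  then obtain u v where x: "x = chi u v"
    unfolding tangent_developable_def tangent_direction_astroid astroid_def chi_def
    by (auto simp: mult.assoc)
  have "(cos u)\<^sup>2 + (sin u)\<^sup>2 = 1" by simp
  then obtain t where t: "0 \<le> t" "t < 2 * pi" "cos u = cos t" "sin u = sin t"
    by (rule sincos_total_2pi)
  then have "x = chi t v" by (simp add: x chi_def cos_double_cos)
  then show "x \<in> {chi u v | u v. 0 \<le> u \<and> u < 2 * pi}" using t by blast
next
  fix x assume "x \<in> {chi u v | u v. 0 \<le> u \<and> u < 2 * pi}"
  then obtain u v where x: "x = astroid u + v *\<^sub>R vector [cos u, - sin u, 2]"
    by (auto simp: chi_def astroid_def)
  have "tangent_direction astroid u (vector [cos u, - sin u, 2])"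
    unfolding tangent_direction_astroid by (intro exI[of _ 1]) simp
  then show "x \<in> tangent_developable astroid" unfolding tangent_developable_def x by blast
qed

theorem proposition5p5:
  fixes f :: "complex^3 \<Rightarrow> complex^3" and C :: "(complex^3) set" and T :: "(real^3) set"
  assumes "f = PA3 2"
    and "C = critical_set f"
    and "T = R3_coords ` ((f ` C \<inter> R3) - (top_whiskers \<union> lower_whiskers))"
  shows "T = tangent_developable astroid \<and>
         T = {chi u v | u v. 0 \<le> u \<and> u < 2 * pi}"
  using real_critical_values tangent_developable_astroid by (simp add: assms)

end
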